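(* Let $(\Omega,\mathcal{F},\mathbb{P},\sigma)$ be a probability measure-preserving dynamical system and let $f:\Omega\to\mathrm{Mon}_1(\mathbb{S}^1)$ be a measurable map, i.e. the generator of a random monotone circle map over $(\Omega,\mathcal{F},\mathbb{P},\sigma)$. Then $f$ has zero random topological entropy: $h^{(\mathrm{r})}_{\mathrm{top}}(f,\omega)=0$ for $\mathbb{P}$-a.e. $\omega\in\Omega$.
   Context: $\mathbb{S}^1=\mathbb{R}/\mathbb{Z}$ with standard metric $d_{\mathbb{S}^1}$. $\mathrm{Mon}_1(\mathbb{S}^1)$ is the set of continuous monotone circle maps of degree one, i.e. continuous circle maps having a lift $F:\mathbb{R}\to\mathbb{R}$ that is continuous, non-decreasing and satisfies $F(x+1)=F(x)+1$. The cocycle generated by $f$ is $f^{(0)}_\omega=\mathrm{Id}$, $f^{(n)}_\omega=f_{\sigma^{n-1}\omega}\circ\cdots\circ f_{\sigma\omega}\circ f_\omega$. The Bowen metric over $n$ steps is $d^f_{\omega,n}(x,y)=\max_{0\le k<n}d_{\mathbb{S}^1}(f^{(k)}_\omega(x),f^{(k)}_\omega(y))$. A set $E\subset\mathbb{S}^1$ is $(n,\varepsilon,\omega)$-separated if $d^f_{\omega,n}(x,y)\ge\varepsilon$ for all distinct $x,y\in E$; $s(n,\varepsilon,\omega,f)$ is the maximal cardinality of such a set. Put $h_\varepsilon(f,\omega)=\limsup_{n\to\infty}\frac1n\log s(n,\varepsilon,\omega,f)$ and $h^{(\mathrm{r})}_{\mathrm{top}}(f,\omega)=\lim_{\varepsilon\to0}h_\varepsilon(f,\omega)$;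 the random topological entropy is the almost sure value of this quantity when it is a.s. constant. *)

theory Defs
  imports "HOL-Probability.Probability"
begin

text \<open>The circle \<open>\<real>/\<int>\<close>, with the quotient metric: the distance of two classes is the distance
  of the difference of representatives to the set of integers.\<close>

quotient_type circle = real / "\<lambda>x y. x - y \<in> \<int>"
proof (rule equivpI)
  show "reflp (\<lambda>x y :: real. x - y \<in> \<int>)"
    by (simp add: reflp_def)
  show "symp (\<lambda>x y :: real. x - y \<in> \<int>)"
    by (metis (no_types, lifting) Ints_minus minus_diff_eq sympI)
  show "transp (\<lambda>x y :: real. x - y \<in> \<int>)"
  proof (rule transpI)
    fix x y z :: real
    assume "x - y \<in> \<int>" "y - z \<in> \<int>"
    then have "(x - y) + (y - z) \<in> \<int>" by (rule Ints_add)
    then show "x - z \<in> \<int>" by simp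
  qed
qed

lift_definition circle_proj :: "real \<Rightarrow> circle" is "\<lambda>x. x" .

lemma infdist_attains_Ints: "\<exists>k\<in>\<int>. infdist (x :: real) \<int> = dist x k"
  using infdist_attains_inf[of "\<int> :: real set" x] closed_Ints Ints_0 by (metis empty_iff)

lemma infdist_Ints_shift_le:
  fixes s t :: real
  assumes "t - s \<in> \<int>"
  shows "infdist s \<int> \<le> infdist t \<int>"
proof -
  obtain k where k: "k \<in> \<int>" "infdist t \<int> = dist t k"
    using infdist_attains_Ints by blast
  have "k - (t - s) \<in> \<int>" using k(1) assms by (rule Ints_diff)
  then have "infdist s \<int> \<le> dist s (k - (t - s))" by (rule infdist_le)
  then show ?thesis using k(2) by (simp add: dist_real_def)
qed

instantiation circle :: metric_space
begin

lift_definition dist_circle :: "circle \<Rightarrow> circle \<Rightarrow> real"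
  is "\<lambda>x y. infdist (x - y) \<int>"
proof -
  fix x x' y y' :: real
  assume "x - x' \<in> \<int>" "y - y' \<in> \<int>"
  then have "(x - x') - (y - y') \<in> \<int>" by (rule Ints_diff)
  then have "(x - y) - (x' - y') \<in> \<int>" by (simp add: algebra_simps)
  moreover from this have "(x' - y') - (x - y) \<in> \<int>"
    by (metis Ints_minus minus_diff_eq)
  ultimately show "infdist (x - y) \<int> = infdist (x' - y') \<int>"
    by (intro antisym infdist_Ints_shift_le)
qed

definition uniformity_circle :: "(circle \<times> circle) filter"
  where "uniformity_circle = (INF e\<in>{0 <..}. principal {(x, y). dist x y < e})"

definition open_circle :: "circle set \<Rightarrow> bool"
  where "open_circle U \<longleftrightarrow> (\<forall>x\<in>U. eventually (\<lambda>(x', y). x' = x \<longrightarrow> y \<in> U) uniformity)"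

instance
proof
  show "uniformity = (INF e\<in>{0 <..}. principal {(x :: circle, y). dist x y < e})"
    by (rule uniformity_circle_def)
  show "open U \<longleftrightarrow> (\<forall>x\<in>U. eventually (\<lambda>(x', y). x' = x \<longrightarrow> y \<in> U) uniformity)"
    for U :: "circle set"
    by (rule open_circle_def)
  show "dist x y = 0 \<longleftrightarrow> x = y" for x y :: circle
  proof transfer
    fix x y :: real
    have "infdist (x - y) \<int> = 0 \<longleftrightarrow> x - y \<in> \<int>"
      using in_closed_iff_infdist_zero[of "\<int> :: real set" "x - y"] closed_Ints Ints_0 by blast
    then show "infdist (x - y) \<int> = 0 \<longleftrightarrow> x - y \<in> \<int>" .
  qed
  show "dist x y \<le> dist x z + dist y z" for x y z :: circle
  proof transfer
    fix x y z :: real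
    obtain k where k: "k \<in> \<int>" "infdist (x - z) \<int> = dist (x - z) k"
      using infdist_attains_Ints by blast
    obtain l where l: "l \<in> \<int>" "infdist (y - z) \<int> = dist (y - z) l"
      using infdist_attains_Ints by blast
    have "infdist (x - y) \<int> \<le> dist (x - y) (k - l)"
      by (intro infdist_le Ints_diff k l)
    also have "\<dots> \<le> dist (x - z) k + dist (y - z) l"
      by (simp add: dist_real_def)
    finally show "infdist (x - y) \<int> \<le> infdist (x - z) \<int> + infdist (y - z) \<int>"
      using k l by simp
  qed
qed

end

lemma dist_circle_proj: "dist (circle_proj x) (circle_proj y) = infdist (x - y) \<int>"
  by transfer simp

lemma circle_proj_eq_iff: "circle_proj x = circle_proj y \<longleftrightarrow> x - y \<in> \<int>"
  by transfer simp

lemma dist_circle_proj_le: "dist (circle_proj x) (circle_proj y) \<le> dist x y"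
  unfolding dist_circle_proj using infdist_le[of 0 "\<int> :: real set" "x - y"]
  by (simp add: dist_real_def)

lemma continuous_on_circle_proj: "continuous_on A circle_proj"
  unfolding continuous_on_iff using dist_circle_proj_le by (meson order_le_less_trans)

lemma surj_circle_proj: "circle_proj ` {0..1} = UNIV"
proof -
  have "z \<in> circle_proj ` {0..1}" for z
  proof -
    obtain x where "z = circle_proj x"
      by transfer (metis Ints_0 diff_self)
    also have "circle_proj x = circle_proj (frac x)"
      by (simp add: circle_proj_eq_iff frac_def)
    finally show ?thesis
      using frac_ge_0[of x] frac_lt_1[of x] by (intro image_eqI) auto
  qed
  then show ?thesis by blast
qed

lemma compact_UNIV_circle: "compact (UNIV :: circle set)"
  using compact_continuous_image[OF continuous_on_circle_proj, of "{0..1}"]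
  by (simp add: surj_circle_proj)

text \<open>Circle maps live in \<^typ>\<open>circle \<Rightarrow>\<^sub>C circle\<close>: by compactness every continuous
  circle map is bounded, so this type consists of all continuous circle maps, and its metric is
  the uniform distance. Its Borel sets give the measurable structure on \<open>Mon\<^sub>1\<close>.\<close>

definition Mon1 :: "(circle \<Rightarrow>\<^sub>C circle) set" where
  "Mon1 = {g. \<exists>F :: real \<Rightarrow> real. continuous_on UNIV F \<and> mono F \<and> (\<forall>x. F (x + 1) = F x + 1) \<and>
      (\<forall>x. apply_bcontfun g (circle_proj x) = circle_proj (F x))}"

primrec cocycle ::
  "('w \<Rightarrow> (circle \<Rightarrow>\<^sub>C circle)) \<Rightarrow> ('w \<Rightarrow> 'w) \<Rightarrow> nat \<Rightarrow> 'w \<Rightarrow> circle \<Rightarrow> circle" where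
  "cocycle f \<sigma> 0 \<omega> = id"
| "cocycle f \<sigma> (Suc n) \<omega> = apply_bcontfun (f ((\<sigma> ^^ n) \<omega>)) \<circ> cocycle f \<sigma> n \<omega>"

text \<open>For \<open>n = 0\<close> the maximum below is over the empty set and hence unspecified; only the
  limit \<open>n \<rightarrow> \<infinity>\<close> is used.\<close>

definition bowen_dist ::
  "('w \<Rightarrow> (circle \<Rightarrow>\<^sub>C circle)) \<Rightarrow> ('w \<Rightarrow> 'w) \<Rightarrow> 'w \<Rightarrow> nat \<Rightarrow> circle \<Rightarrow> circle \<Rightarrow> real" where
  "bowen_dist f \<sigma> \<omega> n x y = (MAX k\<in>{..<n}. dist (cocycle f \<sigma> k \<omega> x) (cocycle f \<sigma> k \<omega> y))"

definition separated ::
  "('w \<Rightarrow> (circle \<Rightarrow>\<^sub>C circle)) \<Rightarrow> ('w \<Rightarrow> 'w) \<Rightarrow> nat \<Rightarrow> real \<Rightarrow> 'w \<Rightarrow> circle set \<Rightarrow> bool" where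
  "separated f \<sigma> n \<epsilon> \<omega> E \<longleftrightarrow> (\<forall>x\<in>E. \<forall>y\<in>E. x \<noteq> y \<longrightarrow> \<epsilon> \<le> bowen_dist f \<sigma> \<omega> n x y)"

definition max_separated ::
  "('w \<Rightarrow> (circle \<Rightarrow>\<^sub>C circle)) \<Rightarrow> ('w \<Rightarrow> 'w) \<Rightarrow> nat \<Rightarrow> real \<Rightarrow> 'w \<Rightarrow> nat" where
  "max_separated f \<sigma> n \<epsilon> \<omega> = Max {card E |E. finite E \<and> separated f \<sigma> n \<epsilon> \<omega> E}"

definition entropy_eps ::
  "('w \<Rightarrow> (circle \<Rightarrow>\<^sub>C circle)) \<Rightarrow> ('w \<Rightarrow> 'w) \<Rightarrow> real \<Rightarrow> 'w \<Rightarrow> ereal" where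
  "entropy_eps f \<sigma> \<epsilon> \<omega> = limsup (\<lambda>n. ereal (1 / real n * ln (real (max_separated f \<sigma> n \<epsilon> \<omega>))))"

definition random_top_entropy ::
  "('w \<Rightarrow> (circle \<Rightarrow>\<^sub>C circle)) \<Rightarrow> ('w \<Rightarrow> 'w) \<Rightarrow> 'w \<Rightarrow> ereal" where
  "random_top_entropy f \<sigma> \<omega> = Lim (at_right 0) (\<lambda>\<epsilon>. entropy_eps f \<sigma> \<epsilon> \<omega>)"

text \<open>Well-definedness: for \<open>n \<ge> 1\<close> and \<open>\<epsilon> > 0\<close> separated sets are finite with
  uniformly bounded cardinality, so the maximum in \<^const>\<open>max_separated\<close> is attained, and the limit
  in \<^const>\<open>random_top_entropy\<close> exists by monotonicity in \<open>\<epsilon>\<close>.\<close>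

lemma continuous_on_cocycle: "continuous_on UNIV (cocycle f \<sigma> n \<omega>)"
proof (induction n)
  case 0
  show ?case by (simp add: id_def)
next
  case (Suc n)
  then show ?case
    unfolding cocycle.simps
    by (intro continuous_on_compose) auto
qed

lemma cocycle_uniform:
  assumes "\<epsilon> > 0"
  shows "\<exists>\<delta>>0. \<forall>x y. dist x y < \<delta> \<longrightarrow> (\<forall>k<n. dist (cocycle f \<sigma> k \<omega> x) (cocycle f \<sigma> k \<omega> y) < \<epsilon>)"
proof (induction n)
  case 0
  show ?case by (intro exI[of _ 1]) auto
next
  case (Suc n)
  then obtain \<delta> where \<delta>: "\<delta> > 0"
    "\<And>x y k. dist x y < \<delta> \<Longrightarrow> k < n \<Longrightarrow> dist (cocycle f \<sigma> k \<omega> x) (cocycle f \<sigma> k \<omega> y) < \<epsilon>"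
    by blast
  have "uniformly_continuous_on UNIV (cocycle f \<sigma> n \<omega>)"
    by (intro compact_uniformly_continuous continuous_on_cocycle compact_UNIV_circle)
  then obtain \<delta>' where \<delta>': "\<delta>' > 0"
    "\<And>x y. dist x y < \<delta>' \<Longrightarrow> dist (cocycle f \<sigma> n \<omega> x) (cocycle f \<sigma> n \<omega> y) < \<epsilon>"
    unfolding uniformly_continuous_on_def using assms by (metis UNIV_I)
  show ?case
    using \<delta> \<delta>' by (intro exI[of _ "min \<delta> \<delta>'"]) (auto simp: less_Suc_eq)
qed

lemma separated_bounded:
  assumes "\<epsilon> > 0" "n > 0"
  shows "\<exists>N. \<forall>E. separated f \<sigma> n \<epsilon> \<omega> E \<longrightarrow> finite E \<and> card E \<le> N"
proof -
  obtain \<delta> where \<delta>: "\<delta> > 0"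
    "\<And>x y k. dist x y < \<delta> \<Longrightarrow> k < n \<Longrightarrow> dist (cocycle f \<sigma> k \<omega> x) (cocycle f \<sigma> k \<omega> y) < \<epsilon>"
    using cocycle_uniform[OF assms(1), of n f \<sigma> \<omega>] by metis
  obtain K :: "circle set" where K: "finite K" "UNIV \<subseteq> (\<Union>x\<in>K. ball x (\<delta> / 2))"
    using conjunct2[OF iffD1[OF compact_eq_totally_bounded compact_UNIV_circle],
        rule_format, OF half_gt_zero[OF \<delta>(1)]] by blast
  have "\<exists>y. y \<in> K \<and> dist y x < \<delta> / 2" for x
  proof -
    have "x \<in> (\<Union>y\<in>K. ball y (\<delta> / 2))" using K(2) by (rule subsetD) simp
    then show ?thesis by auto
  qed
  then obtain c where c: "\<And>x. c x \<in> K \<and> dist (c x) x < \<delta> / 2"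
    by metis
  have "finite E \<and> card E \<le> card K" if E: "separated f \<sigma> n \<epsilon> \<omega> E" for E
  proof -
    have "inj_on c E"
    proof (rule inj_onI, rule ccontr)
      fix x y assume xy: "x \<in> E" "y \<in> E" "c x = c y" "x \<noteq> y"
      have "dist x y < \<delta>"
        using c[of x] c[of y] xy(3) dist_triangle_half_r[of "c x" x \<delta> y] by simp
      then have "bowen_dist f \<sigma> \<omega> n x y < \<epsilon>"
        unfolding bowen_dist_def using \<delta>(2) assms(2) by (subst Max_less_iff) (simp_all add: lessThan_empty_iff)
      moreover have "\<epsilon> \<le> bowen_dist f \<sigma> \<omega> n x y"
        using E xy unfolding separated_def by blast
      ultimately show False by simp
    qed
    moreover have "c ` E \<subseteq> K" using c by auto
    ultimately show ?thesis
      using K(1) card_inj_on_le[of c E K] inj_on_finite[of c E K] by simp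
  qed
  then show ?thesis by (intro exI[of _ "card K"] allI impI)
qed

lemma finite_separated_cards:
  assumes "\<epsilon> > 0" "n > 0"
  shows "finite {card E |E. finite E \<and> separated f \<sigma> n \<epsilon> \<omega> E}"
proof -
  obtain N where "\<And>E. separated f \<sigma> n \<epsilon> \<omega> E \<Longrightarrow> card E \<le> N"
    using separated_bounded[OF assms, of f \<sigma> \<omega>] by metis
  then show ?thesis by (auto intro!: finite_subset[OF _ finite_atMost[of N]])
qed

lemma max_separated_antimono:
  assumes "0 < \<epsilon>" "\<epsilon> \<le> \<epsilon>'" "n > 0"
  shows "max_separated f \<sigma> n \<epsilon>' \<omega> \<le> max_separated f \<sigma> n \<epsilon> \<omega>"
  unfolding max_separated_def
proof (rule Max_mono)
  show "{card E |E. finite E \<and> separated f \<sigma> n \<epsilon>' \<omega> E} \<subseteq> {card E |E. finite E \<and> separated f \<sigma> n \<epsilon> \<omega> E}"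
    using assms(2) unfolding separated_def by fastforce
  show "{card E |E. finite E \<and> separated f \<sigma> n \<epsilon>' \<omega> E} \<noteq> {}"
    unfolding separated_def by blast
  show "finite {card E |E. finite E \<and> separated f \<sigma> n \<epsilon> \<omega> E}"
    using assms by (intro finite_separated_cards)
qed

lemma max_separated_pos:
  assumes "\<epsilon> > 0" "n > 0"
  shows "max_separated f \<sigma> n \<epsilon> \<omega> \<ge> 1"
  unfolding max_separated_def
proof (rule Max_ge[OF finite_separated_cards[OF assms]])
  show "1 \<in> {card E |E. finite E \<and> separated f \<sigma> n \<epsilon> \<omega> E}"
    by (auto intro!: exI[of _ "{undefined}"] simp: separated_def)
qed

lemma entropy_eps_antimono:
  assumes "0 < \<epsilon>" "\<epsilon> \<le> \<epsilon>'"
  shows "entropy_eps f \<sigma> \<epsilon>' \<omega> \<le> entropy_eps f \<sigma> \<epsilon> \<omega>"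
  unfolding entropy_eps_def
proof (rule Limsup_mono, rule eventually_mono[OF eventually_gt_at_top[of 0]])
  fix n :: nat assume n: "0 < n"
  have "ln (real (max_separated f \<sigma> n \<epsilon>' \<omega>)) \<le> ln (real (max_separated f \<sigma> n \<epsilon> \<omega>))"
    using max_separated_antimono[OF assms n, of f \<sigma> \<omega>] max_separated_pos[of \<epsilon>' n f \<sigma> \<omega>] assms n
    by (intro ln_mono) auto
  then show "ereal (1 / real n * ln (real (max_separated f \<sigma> n \<epsilon>' \<omega>)))
      \<le> ereal (1 / real n * ln (real (max_separated f \<sigma> n \<epsilon> \<omega>)))"
    by (simp add: divide_right_mono)
qed

lemma entropy_eps_tendsto:
  "((\<lambda>\<epsilon>. entropy_eps f \<sigma> \<epsilon> \<omega>) \<longlongrightarrow> random_top_entropy f \<sigma> \<omega>) (at_right 0)"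
proof -
  let ?h = "\<lambda>\<epsilon>. entropy_eps f \<sigma> \<epsilon> \<omega>"
  have "(?h \<longlongrightarrow> (SUP \<epsilon>\<in>{0<..}. ?h \<epsilon>)) (at_right 0)"
  proof (rule order_tendstoI)
    fix a assume "a < (SUP \<epsilon>\<in>{0<..}. ?h \<epsilon>)"
    then obtain e where e: "e > 0" "a < ?h e" by (auto simp: less_SUP_iff)
    have "eventually (\<lambda>\<epsilon>. \<epsilon> \<in> {0<..<e}) (at_right 0)"
      using e(1) by (rule eventually_at_right_real)
    then show "eventually (\<lambda>\<epsilon>. a < ?h \<epsilon>) (at_right 0)"
      by (rule eventually_mono)
        (use e entropy_eps_antimono[of _ e f \<sigma> \<omega>] in \<open>auto intro: less_le_trans\<close>)
  next
    fix a assume a: "(SUP \<epsilon>\<in>{0<..}. ?h \<epsilon>) < a"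
    have *: "?h \<epsilon> < a" if "\<epsilon> > 0" for \<epsilon>
    proof -
      have "?h \<epsilon> \<le> (SUP \<epsilon>\<in>{0<..}. ?h \<epsilon>)" using that by (intro SUP_upper) simp
      then show ?thesis using a by (rule le_less_trans)
    qed
    show "eventually (\<lambda>\<epsilon>. ?h \<epsilon> < a) (at_right 0)"
      by (rule eventually_mono[OF eventually_at_right_less[of 0]]) (rule *)
  qed
  then show ?thesis
    unfolding random_top_entropy_def using tendsto_Lim[OF trivial_limit_at_right_real] by metis
qed

end

theory Submission
  imports Defs "HOL-Real_Asymp.Real_Asymp"
begin

text \<open>The bound is deterministic: it holds for every sequence of maps in \<^const>\<open>Mon1\<close>. If
  \<open>G\<^sub>k\<close> are monotone lifts of the iterates, the integer \<open>\<Sum>k<n. \<lfloor>N G\<^sub>k x\<rfloor>\<close> is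
  non-decreasing in \<open>x\<close> and grows by \<open>n N\<close> over a unit interval. Where it is constant, each summand
  is constant, so every \<open>G\<^sub>k\<close> varies by less than \<open>1/N\<close>. Hence an \<open>(n, 1/N)\<close>-separated set has at
  most \<open>n N + 1\<close> points, and linear growth gives entropy zero.\<close>

text \<open>Phrased for plain functions, so that it passes from the generators to the composites
  forming the cocycle.\<close>

definition deg1_lift :: "(real \<Rightarrow> real) \<Rightarrow> (circle \<Rightarrow> circle) \<Rightarrow> bool" where
  "deg1_lift G g \<longleftrightarrow> mono G \<and> (\<forall>x. G (x + 1) = G x + 1) \<and> (\<forall>x. g (circle_proj x) = circle_proj (G x))"

lemma deg1_lift_id: "deg1_lift id id"
  by (simp add: deg1_lift_def mono_def)

lemma deg1_lift_comp:
  assumes "deg1_lift F f" "deg1_lift G g"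
  shows "deg1_lift (F \<circ> G) (f \<circ> g)"
  using assms by (simp add: deg1_lift_def mono_def)

lemma Mon1_deg1_lift: "g \<in> Mon1 \<Longrightarrow> \<exists>F. deg1_lift F (apply_bcontfun g)"
  unfolding Mon1_def deg1_lift_def by blast

lemma cocycle_deg1_lift:
  assumes "\<And>k. f ((\<sigma> ^^ k) \<omega>) \<in> Mon1"
  shows "\<exists>G. deg1_lift G (cocycle f \<sigma> n \<omega>)"
proof (induction n)
  case 0
  show ?case using deg1_lift_id by (auto simp del: id_apply)
next
  case (Suc n)
  then show ?case
    using Mon1_deg1_lift[OF assms[of n]] deg1_lift_comp by (metis cocycle.simps(2))
qed

text \<open>Reals with equal floors share a half-open unit interval; dividing by \<open>c\<close>
  rescales it.\<close>

lemma dist_less_of_floor_eq: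
  fixes a b c :: real
  assumes "c > 0" "\<lfloor>c * a\<rfloor> = \<lfloor>c * b\<rfloor>"
  shows "dist a b < 1 / c"
proof -
  have "\<bar>c * a - c * b\<bar> < 1"
    using assms(2) by linarith
  then have "c * dist a b < 1"
    using assms(1) by (simp add: dist_real_def abs_mult flip: right_diff_distrib)
  then show ?thesis
    using assms(1) by (simp add: field_simps)
qed

lemma separated_card_le:
  assumes mon: "\<And>k. f ((\<sigma> ^^ k) \<omega>) \<in> Mon1"
    and N: "N > 0" "1 / real N \<le> \<epsilon>" and n: "n > 0"
    and E: "finite E" "separated f \<sigma> n \<epsilon> \<omega> E"
  shows "card E \<le> n * N + 1"
proof -
  obtain G where G: "\<And>k. deg1_lift (G k) (cocycle f \<sigma> k \<omega>)"
    using cocycle_deg1_lift[of f \<sigma> \<omega>, OF mon] by metis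
  \<comment> \<open>\<open>r\<close> picks a representative of each circle point in one period,
    where the lifts can be compared by order.\<close>
  obtain r where r: "\<And>z. r z \<in> {0..1}" "\<And>z. circle_proj (r z) = z"
    using surj_circle_proj by (metis UNIV_I image_iff)
  define t where "t k x = \<lfloor>real N * G k x\<rfloor>" for k x
  define c where "c x = (\<Sum>k<n. t k x)" for x
  have t_mono: "t k x \<le> t k y" if "x \<le> y" for k x y
    unfolding t_def using G[of k] that
    by (intro floor_mono mult_left_mono) (auto simp: deg1_lift_def mono_def)
  have c_mono: "c x \<le> c y" if "x \<le> y" for x y
    unfolding c_def using that by (intro sum_mono t_mono)
  \<comment> \<open>Since \<open>N\<close> is an integer, the unit increase of \<open>G k\<close>
    over a period raises the floor by exactly \<open>N\<close>.\<close>
  have "t k 1 = t k 0 + int N" for k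
  proof -
    have "G k 1 = G k 0 + 1"
      using G[of k] unfolding deg1_lift_def by (metis add_0)
    then have "real N * G k 1 = real N * G k 0 + of_int (int N)"
      by (simp add: algebra_simps)
    then show ?thesis
      unfolding t_def by (metis floor_add_int)
  qed
  then have c_one: "c 1 = c 0 + int (n * N)"
    unfolding c_def by (simp add: sum.distrib)
  \<comment> \<open>The differences \<open>t k y - t k x\<close> are nonnegative, so a zero sum
    forces each to vanish.\<close>
  have t_eq: "t k x = t k y" if "c x = c y" "x \<le> y" "k < n" for k x y
  proof -
    have "(\<Sum>k<n. t k y - t k x) = 0"
      using that(1) by (simp add: c_def sum_subtractf)
    then show ?thesis
      using t_mono[OF that(2)] that(3) by (subst (asm) sum_nonneg_eq_0_iff) auto
  qed
  \<comment> \<open>Two points with the same value of \<open>c\<close> would stay closer than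
    \<open>\<epsilon>\<close> at all times \<open>k < n\<close>, contradicting separation.\<close>
  have "inj_on (c \<circ> r) E"
  proof (rule inj_onI, rule ccontr)
    fix x y assume xy: "x \<in> E" "y \<in> E" "(c \<circ> r) x = (c \<circ> r) y" "x \<noteq> y"
    have "dist (cocycle f \<sigma> k \<omega> x) (cocycle f \<sigma> k \<omega> y) < \<epsilon>" if k: "k < n" for k
    proof -
      have "t k (r x) = t k (r y)"
        using t_eq[of "r x" "r y" k] t_eq[of "r y" "r x" k] xy(3) k by fastforce
      then have "dist (G k (r x)) (G k (r y)) < 1 / real N"
        using N(1) by (intro dist_less_of_floor_eq) (auto simp: t_def)
      then have "dist (circle_proj (G k (r x))) (circle_proj (G k (r y))) < \<epsilon>"
        using dist_circle_proj_le[of "G k (r x)" "G k (r y)"] N(2) by linarith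
      then show ?thesis
        using G[of k] r(2) unfolding deg1_lift_def by metis
    qed
    then have "bowen_dist f \<sigma> \<omega> n x y < \<epsilon>"
      unfolding bowen_dist_def using n by (subst Max_less_iff) (auto simp: lessThan_empty_iff)
    then show False
      using E(2) xy unfolding separated_def by fastforce
  qed
  moreover have "(c \<circ> r) ` E \<subseteq> {c 0..c 0 + int (n * N)}"
    using c_mono[of 0] c_mono[of _ 1] r(1) unfolding c_one by auto
  ultimately have "card E \<le> card {c 0..c 0 + int (n * N)}"
    by (rule card_inj_on_le) simp
  also have "\<dots> = n * N + 1"
    by (simp add: nat_add_distrib nat_mult_distrib)
  finally show ?thesis .
qed

text \<open>The bound passes to \<open>Max\<close> because the set of cardinalities is finite and,
  thanks to the empty set, nonempty.\<close>

lemma max_separated_le: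
  assumes "\<And>k. f ((\<sigma> ^^ k) \<omega>) \<in> Mon1"
    and N: "N > 0" "1 / real N \<le> \<epsilon>" and "n > 0"
  shows "max_separated f \<sigma> n \<epsilon> \<omega> \<le> n * N + 1"
proof -
  have "\<epsilon> > 0"
    using N by (smt (verit) of_nat_0_less_iff zero_less_divide_1_iff)
  have "separated f \<sigma> n \<epsilon> \<omega> {}"
    by (simp add: separated_def)
  then have "{card E |E. finite E \<and> separated f \<sigma> n \<epsilon> \<omega> E} \<noteq> {}"
    by blast
  then show ?thesis
    unfolding max_separated_def
    using finite_separated_cards[OF \<open>\<epsilon> > 0\<close> \<open>n > 0\<close>]
      separated_card_le[of f \<sigma> \<omega> N \<epsilon> n, OF assms]
    by (subst Max_le_iff) auto
qed

text \<open>With \<open>N\<close> fixed by \<open>\<epsilon>\<close>, the count lies between 1 and a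
  linear function of \<open>n\<close>, whose logarithm is o(n).\<close>

lemma entropy_eps_eq_0:
  assumes mon: "\<And>k. f ((\<sigma> ^^ k) \<omega>) \<in> Mon1" and "\<epsilon> > 0"
  shows "entropy_eps f \<sigma> \<epsilon> \<omega> = 0"
proof -
  obtain N :: nat where N: "N > 0" "1 / real N < \<epsilon>"
    using nat_approx_posE[OF \<open>\<epsilon> > 0\<close>] by (metis zero_less_Suc)
  let ?s = "\<lambda>n. max_separated f \<sigma> n \<epsilon> \<omega>"
  have pos: "?s n \<ge> 1" if "n > 0" for n
    using max_separated_pos[OF \<open>\<epsilon> > 0\<close> that] .
  have le: "real (?s n) \<le> real n * real N + 1" if "n > 0" for n
    using max_separated_le[of f \<sigma> \<omega> N \<epsilon> n, OF mon] N that
    by (metis less_imp_le of_nat_1 of_nat_add of_nat_le_iff of_nat_mult)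
  have "(\<lambda>n. 1 / real n * ln (real (?s n))) \<longlonglongrightarrow> 0"
  proof (rule tendsto_sandwich[of "\<lambda>_. 0" _ _ "\<lambda>n. 1 / real n * ln (real n * real N + 1)"])
    \<comment> \<open>Only \<open>n > 0\<close> is considered, as the Bowen maximum is unspecified
      at 0.\<close>
    show "\<forall>\<^sub>F n in sequentially. 0 \<le> 1 / real n * ln (real (?s n))"
      using eventually_gt_at_top[of 0] by eventually_elim (use pos in auto)
    show "\<forall>\<^sub>F n in sequentially.
        1 / real n * ln (real (?s n)) \<le> 1 / real n * ln (real n * real N + 1)"
      using eventually_gt_at_top[of 0]
    proof eventually_elim
      case (elim n)
      then show ?case
        using le[OF elim] pos[OF elim] by (intro mult_left_mono ln_mono) auto
    qed
    have "real N > 0" using N(1) by simp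
    then show "(\<lambda>n. 1 / real n * ln (real n * real N + 1)) \<longlonglongrightarrow> 0"
      by real_asymp
  qed simp
  then have "(\<lambda>n. ereal (1 / real n * ln (real (?s n)))) \<longlonglongrightarrow> 0"
    by (simp add: zero_ereal_def)
  then show ?thesis
    unfolding entropy_eps_def by (intro lim_imp_Limsup) simp_all
qed

text \<open>\<open>entropy_eps\<close> vanishes for every \<open>\<epsilon> > 0\<close>, and limits
  are unique.\<close>

lemma random_top_entropy_eq_0:
  assumes "\<And>k. f ((\<sigma> ^^ k) \<omega>) \<in> Mon1"
  shows "random_top_entropy f \<sigma> \<omega> = 0"
proof -
  have "((\<lambda>\<epsilon>. entropy_eps f \<sigma> \<epsilon> \<omega>) \<longlongrightarrow> 0) (at_right 0)"
    by (intro tendsto_eventually eventually_mono[OF eventually_at_right_less[of 0]]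
        entropy_eps_eq_0 assms)
  then show ?thesis
    using entropy_eps_tendsto[of f \<sigma> \<omega>] tendsto_unique[OF trivial_limit_at_right_real] by blast
qed

theorem proposition2p1:
  fixes M :: "'w measure"
    and \<sigma> :: "'w \<Rightarrow> 'w"
    and f :: "'w \<Rightarrow> (circle \<Rightarrow>\<^sub>C circle)"
  assumes "prob_space M"
    and "\<sigma> \<in> M \<rightarrow>\<^sub>M M"
    and "distr M M \<sigma> = M"
    and "f \<in> M \<rightarrow>\<^sub>M restrict_space borel Mon1"
  shows "AE \<omega> in M. random_top_entropy f \<sigma> \<omega> = 0"
\<comment> \<open>The claim is shown at every point of \<open>space M\<close>: its orbit stays
  there, so all generators along it lie in \<open>Mon1\<close>.\<close>
proof (rule AE_I2, rule random_top_entropy_eq_0)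
  fix \<omega> k assume "\<omega> \<in> space M"
  then have "(\<sigma> ^^ k) \<omega> \<in> space M"
    by (induction k) (auto intro: measurable_space[OF assms(2)])
  then show "f ((\<sigma> ^^ k) \<omega>) \<in> Mon1"
    using measurable_space[OF assms(4)] by (simp add: space_restrict_space)
qed

end
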